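(* Let $r_{k,m}$ denote the number of plateau polycubes of width $k$ and lateral area $m$. Then, for all integers $k\geq 1$ and $m\geq 2k$, $$r_{k,m}=\sum_{i=k}^{m-k}\alpha_k(i)\,\alpha_k(m-i),$$ where $$\alpha_{k}(u)=\sum_{i,j\geq 0}\binom{k-i-1}{i}\binom{2k+j-2}{j}\binom{k-2i-1}{u-k-i-j}.$$
   Context: A cell is a unit cube of the lattice $\mathbb{Z}^3$ with orthonormal coordinate system $(0,\vec i,\vec j,\vec k)$. A polycube is a finite (nonempty) union of cells, connected through their faces, and considered up to translation. Its width is the difference between its greatest and smallest indices (coordinates of its points) in the direction $\vec i$, i.e. the number of layers of cells it occupies in direction $\vec i$. A stratum is a polycube of width $1$; a plateau is a rectangular stratum (a full $1\times b\times c$ block of cells, of extent $1$ in direction $\vec i$). A plateau polycube is a polycube whose strata (its intersections with the successive unit-width layers orthogonal to $\vec i$) are all plateaus. The lateral area of a polycube is the sum of the areas (numbers of unit squares) of its projections onto the planes $(\vec i,\vec j)$ and $(\vec i,\vec k)$. Convention: $\binom{n}{k}=\frac{n!}{k!(n-k)!}$ if $0\le k\le n$ and $\binom{n}{k}=0$ otherwise. *)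

theory Defs
  imports Main "HOL-Library.Product_Plus" "HOL-Library.Groups_Big_Fun"
begin

section \<open>Polycubes\<close>

text \<open>The cell \<open>(x, y, z)\<close> stands for the unit cube \<open>[x, x+1] \<times> [y, y+1] \<times> [z, z+1]\<close>, and a union
  of cells is represented by the set of its cells. The coordinates \<open>x\<close>, \<open>y\<close>, \<open>z\<close> belong to the
  directions \<open>i\<close>, \<open>j\<close>, \<open>k\<close> respectively.\<close>

type_synonym cell = "int \<times> int \<times> int"

fun share_face :: "cell \<Rightarrow> cell \<Rightarrow> bool" where
  "share_face (x, y, z) (x', y', z') \<longleftrightarrow> \<bar>x - x'\<bar> + \<bar>y - y'\<bar> + \<bar>z - z'\<bar> = 1"

definition face_connected :: "cell set \<Rightarrow> bool" where
  "face_connected P \<longleftrightarrow>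
     (\<forall>c\<in>P. \<forall>d\<in>P. (c, d) \<in> {(a, b). a \<in> P \<and> b \<in> P \<and> share_face a b}\<^sup>*)"

text \<open>Polycubes placed in the lattice; the identification up to translation is made in
  \<open>num_plateau_polycubes\<close> below.\<close>

definition polycube :: "cell set \<Rightarrow> bool" where
  "polycube P \<longleftrightarrow> finite P \<and> P \<noteq> {} \<and> face_connected P"

text \<open>The points of a cell with index \<open>x\<close> have first coordinates from \<open>x\<close> to \<open>x + 1\<close>.\<close>

definition width :: "cell set \<Rightarrow> int" where
  "width P = (Max (fst ` P) + 1) - Min (fst ` P)"

definition stratum :: "cell set \<Rightarrow> bool" where
  "stratum S \<longleftrightarrow> polycube S \<and> width S = 1"

definition plateau :: "cell set \<Rightarrow> bool" where
  "plateau S \<longleftrightarrow> stratum S \<and>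
     (\<exists>x y z (b :: nat) (c :: nat). S = {x} \<times> {y..<y + int b} \<times> {z..<z + int c})"

definition layer :: "cell set \<Rightarrow> int \<Rightarrow> cell set" where
  "layer P x = {c \<in> P. fst c = x}"

definition plateau_polycube :: "cell set \<Rightarrow> bool" where
  "plateau_polycube P \<longleftrightarrow> polycube P \<and> (\<forall>x \<in> fst ` P. plateau (layer P x))"

definition lateral_area :: "cell set \<Rightarrow> nat" where
  "lateral_area P = card ((\<lambda>(x, y, z). (x, y)) ` P) + card ((\<lambda>(x, y, z). (x, z)) ` P)"

definition translation_rel :: "(cell set \<times> cell set) set" where
  "translation_rel = {(P, Q). \<exists>v. Q = (+) v ` P}"

lemma equiv_translation_rel: "equiv UNIV translation_rel"
proof (rule equivI)
  show "refl translation_rel"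
  proof (rule refl_onI)
    fix P :: "cell set"
    have "P = (+) 0 ` P" by (simp only: image_add_0)
    then show "(P, P) \<in> translation_rel" unfolding translation_rel_def by blast
  qed
  show "sym translation_rel"
  proof (rule symI)
    fix P Q assume "(P, Q) \<in> translation_rel"
    then obtain v where "Q = (+) v ` P" by (auto simp: translation_rel_def)
    then have "P = (+) (- v) ` Q" by (simp add: image_image)
    then show "(Q, P) \<in> translation_rel" unfolding translation_rel_def by blast
  qed
  show "trans translation_rel"
  proof (rule transI)
    fix P Q R assume "(P, Q) \<in> translation_rel" "(Q, R) \<in> translation_rel"
    then obtain v w where "Q = (+) v ` P" "R = (+) w ` Q" by (auto simp: translation_rel_def)
    then have "R = (+) (w + v) ` P" by (simp add: image_image add.assoc)
    then show "(P, R) \<in> translation_rel" unfolding translation_rel_def by blast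
  qed
qed simp

definition num_plateau_polycubes :: "int \<Rightarrow> int \<Rightarrow> nat" where
  "num_plateau_polycubes k m =
     card ({P. plateau_polycube P \<and> width P = k \<and> int (lateral_area P) = m} // translation_rel)"


section \<open>The coefficients\<close>

text \<open>Unlike \<open>choose\<close> (natural arguments) and \<open>gchoose\<close> (nonzero for negative upper arguments), this
  binomial coefficient vanishes unless \<open>0 \<le> k \<le> n\<close>.\<close>

definition binom :: "int \<Rightarrow> int \<Rightarrow> nat" where
  "binom n k = (if 0 \<le> k \<and> k \<le> n then nat n choose nat k else 0)"

definition alpha_term :: "int \<Rightarrow> int \<Rightarrow> nat \<times> nat \<Rightarrow> nat" where
  "alpha_term k u = (\<lambda>(i, j).
     binom (k - int i - 1) (int i) * binom (2 * k + int j - 2) (int j) *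
     binom (k - 2 * int i - 1) (u - k - int i - int j))"

text \<open>\<open>Sum_any\<close> sums over all pairs \<open>(i, j)\<close> of natural numbers; by the next lemma only finitely many
  terms are nonzero, so the sum is not the default value \<open>0\<close>.\<close>

lemma finite_alpha_term_support: "finite {p. alpha_term k u p \<noteq> 0}"
proof (rule finite_subset)
  show "{p. alpha_term k u p \<noteq> 0} \<subseteq> {..nat k} \<times> {..nat (u - k)}"
    by (auto simp: alpha_term_def binom_def split: if_splits)
qed simp

definition alpha :: "int \<Rightarrow> int \<Rightarrow> nat" where
  "alpha k u = Sum_any (alpha_term k u)"

end

theory Submission
  imports Defs "HOL-Computational_Algebra.Formal_Power_Series"
begin

text \<open>A plateau is the product of a unit interval and two intervals, one in each lateral direction, and
  two consecutive plateaus are joined by a face exactly when their intervals meet in both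
  directions. The two lateral directions are therefore independent: up to translation, a plateau
  polycube of width \<open>k\<close> is a pair of \<^emph>\<open>chains\<close>, sequences of \<open>k\<close> nonempty integer intervals in which
  neighbours meet, each normalised so that its first interval starts at \<open>0\<close>. Each chain is the
  projection of the polycube in one of the two directions, so the lateral area is the sum of the
  total lengths of the two chains. Hence the number sought is the convolution of the number of
  chains with itself, and it remains to see that \<open>alpha k u\<close> counts the chains of \<open>k\<close> intervals of
  total length \<open>u\<close>.

  An interval of length \<open>a\<close> meets \<open>a + b - 1\<close> intervals of length \<open>b\<close>, so chains with lengths
  \<open>a\<^sub>1, \<dots>, a\<^sub>k\<close> number \<open>\<Prod> (a\<^sub>i + a\<^sub>i\<^sub>+\<^sub>1 - 1)\<close>. Because this weight is affine in each length, two
  power series are enough to describe the passage from \<open>k\<close> to \<open>k + 1\<close>: the generating function \<open>F\<^sub>k\<close>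
  of chains by total length, and \<open>G\<^sub>k\<close>, in which each chain is weighted by its first length. Writing
  \<open>g = 1 / (1 - X)\<close>, the transfer matrix is
  \<open>F\<^sub>k\<^sub>+\<^sub>1 = X\<^sup>2 g\<^sup>2 F\<^sub>k + X g G\<^sub>k\<close>, \<open>G\<^sub>k\<^sub>+\<^sub>1 = 2 X\<^sup>2 g\<^sup>3 F\<^sub>k + X g\<^sup>2 G\<^sub>k\<close>,
  with trace \<open>X g\<^sup>2 (1 + X)\<close> and determinant \<open>- X\<^sup>3 g\<^sup>4\<close>. Eliminating \<open>G\<close> leaves a recurrence of order
  two, which after splitting off \<open>X\<^sup>k g\<^bsup>2k-1\<^esup>\<close> becomes the recurrence of the Fibonacci polynomials,
  \<open>p\<^sub>n\<^sub>+\<^sub>2 = (1 + X) p\<^sub>n\<^sub>+\<^sub>1 + X p\<^sub>n\<close>. This is \<open>chain_series\<close>; the three binomial coefficients of \<open>alpha\<close>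
  are the coefficients of the Fibonacci polynomial, of the power of \<open>g\<close> and of the powers of
  \<open>1 + X\<close>.\<close>

section \<open>Chains of overlapping intervals\<close>

text \<open>An interval is given by its left end and its length.\<close>

definition extent :: "int \<times> nat \<Rightarrow> int set" where
  "extent I = {fst I..<fst I + int (snd I)}"

definition chain :: "(int \<times> nat) list \<Rightarrow> bool" where
  "chain xs \<longleftrightarrow> (\<forall>I\<in>set xs. 0 < snd I) \<and> successively (\<lambda>I J. extent I \<inter> extent J \<noteq> {}) xs"

definition total_length :: "(int \<times> nat) list \<Rightarrow> nat" where
  "total_length xs = sum_list (map snd xs)"

definition chains_from :: "nat \<Rightarrow> int \<times> nat \<Rightarrow> nat \<Rightarrow> (int \<times> nat) list set" where
  "chains_from n I u = {xs. length xs = Suc n \<and> hd xs = I \<and> chain xs \<and> total_length xs = u}"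

definition based_chains :: "nat \<Rightarrow> nat \<Rightarrow> (int \<times> nat) list set" where
  "based_chains k u = {xs. length xs = k \<and> fst (hd xs) = 0 \<and> chain xs \<and> total_length xs = u}"

lemma extent_meet_iff:
  assumes "0 < snd I" "0 < snd J"
  shows "extent I \<inter> extent J \<noteq> {} \<longleftrightarrow> fst I < fst J + int (snd J) \<and> fst J < fst I + int (snd I)"
proof
  assume "fst I < fst J + int (snd J) \<and> fst J < fst I + int (snd I)"
  then have "max (fst I) (fst J) \<in> extent I \<inter> extent J"
    using assms by (auto simp: extent_def)
  then show "extent I \<inter> extent J \<noteq> {}" by blast
qed (auto simp: extent_def)

text \<open>This bound is the reason why the convolution only runs from \<open>k\<close> to \<open>m - k\<close>.\<close>

lemma length_le_total_length:
  assumes "chain xs"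
  shows "length xs \<le> total_length xs"
proof -
  have "(\<Sum>x\<leftarrow>xs. 1) \<le> (\<Sum>x\<leftarrow>xs. snd x)"
    using assms by (intro sum_list_mono) (auto simp: chain_def Suc_le_eq)
  then show ?thesis by (simp add: total_length_def sum_list_triv)
qed

lemma chains_from_0: "chains_from 0 (s, a) u = (if 1 \<le> a \<and> u = a then {[(s, a)]} else {})"
  by (auto simp: chains_from_def chain_def total_length_def length_Suc_conv)

text \<open>Removing the first interval leaves a chain whose first interval, of length \<open>b\<close>, may start at
  any \<open>t\<close> that makes it meet \<open>{s..<s + a}\<close>.\<close>

lemma chains_from_Suc:
  "chains_from (Suc n) (s, a) u = (if 1 \<le> a \<and> a \<le> u
     then \<Union>(b, t)\<in>(SIGMA b:{1..u - a}. {s - int b<..<s + int a}). Cons (s, a) ` chains_from n (t, b) (u - a)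
     else {})" (is "_ = ?R")
proof (intro set_eqI iffI)
  fix xs assume "xs \<in> chains_from (Suc n) (s, a) u"
  then obtain ys where xs: "xs = (s, a) # ys" and len: "length ys = Suc n"
    and ch: "chain ((s, a) # ys)" and tot: "a + total_length ys = u"
    by (auto simp: chains_from_def length_Suc_conv total_length_def)
  obtain t b where hd: "hd ys = (t, b)" by force
  have ne: "ys \<noteq> []" using len by auto
  have a: "0 < a" and cy: "chain ys" and b: "0 < b" and meet: "extent (s, a) \<inter> extent (t, b) \<noteq> {}"
    using ch ne hd hd_in_set[OF ne] by (force simp: chain_def successively_Cons)+
  have "b \<le> total_length ys"
    using ne hd by (cases ys) (auto simp: total_length_def)
  moreover have "ys \<in> chains_from n (t, b) (u - a)"
    using len hd cy tot by (auto simp: chains_from_def)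
  moreover have "t \<in> {s - int b<..<s + int a}"
    using extent_meet_iff[of "(s, a)" "(t, b)"] a b meet by auto
  ultimately show "xs \<in> ?R"
    using a b tot by (auto simp: xs intro!: bexI[of _ b] bexI[of _ t])
next
  fix xs assume R: "xs \<in> ?R"
  then have au: "1 \<le> a" "a \<le> u" by (auto split: if_splits)
  with R obtain b t ys where b: "1 \<le> b" and t: "s - int b < t" "t < s + int a"
    and ys: "ys \<in> chains_from n (t, b) (u - a)" and xs: "xs = (s, a) # ys"
    by auto
  have "extent (s, a) \<inter> extent (t, b) \<noteq> {}"
    using extent_meet_iff[of "(s, a)" "(t, b)"] au b t by auto
  then show "xs \<in> chains_from (Suc n) (s, a) u"
    using ys au by (auto simp: xs chains_from_def chain_def total_length_def successively_Cons)
qed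

text \<open>The number of chains of \<open>n + 1\<close> intervals with a given first interval of length \<open>a\<close> and total
  length \<open>u\<close>. The factor \<open>a + b - 1\<close> counts the positions of the next interval.\<close>

primrec chain_weight :: "nat \<Rightarrow> nat \<Rightarrow> nat \<Rightarrow> nat" where
  "chain_weight 0 a u = (if 1 \<le> a \<and> u = a then 1 else 0)"
| "chain_weight (Suc n) a u =
     (if 1 \<le> a \<and> a \<le> u then \<Sum>b=1..u - a. (a + b - 1) * chain_weight n b (u - a) else 0)"

text \<open>The left end has to be arbitrary in the induction, since the second interval takes several
  positions. Finiteness is carried along because the cardinality of the union depends on it.\<close>

lemma card_chains_from:
  "finite (chains_from n (s, a) u) \<and> card (chains_from n (s, a) u) = chain_weight n a u"
proof (induction n arbitrary: s a u)
  case 0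
  show ?case by (simp add: chains_from_0)
next
  case (Suc n)
  show ?case
  proof (cases "1 \<le> a \<and> a \<le> u")
    case True
    let ?S = "SIGMA b:{1..u - a}. {s - int b<..<s + int a}"
    let ?C = "\<lambda>(b, t). Cons (s, a) ` chains_from n (t, b) (u - a)"
    have eq: "chains_from (Suc n) (s, a) u = (\<Union>p\<in>?S. ?C p)"
      using True by (simp add: chains_from_Suc)
    have fin: "finite (?C p)" for p
      using Suc.IH by (cases p) auto
    have "card (\<Union>p\<in>?S. ?C p) = (\<Sum>p\<in>?S. card (?C p))"
    proof (rule card_UN_disjoint)
      show "\<forall>p\<in>?S. \<forall>q\<in>?S. p \<noteq> q \<longrightarrow> ?C p \<inter> ?C q = {}"
        by (auto simp: chains_from_def)
    qed (use fin in auto)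
    also have "\<dots> = (\<Sum>p\<in>?S. chain_weight n (fst p) (u - a))"
      using Suc.IH by (intro sum.cong refl) (auto simp: card_image)
    also have "\<dots> = (\<Sum>b=1..u - a. \<Sum>t\<in>{s - int b<..<s + int a}. chain_weight n b (u - a))"
      by (subst sum.Sigma) (auto simp: case_prod_beta)
    also have "\<dots> = (\<Sum>b=1..u - a. (a + b - 1) * chain_weight n b (u - a))"
      by (intro sum.cong refl) (auto intro!: arg_cong[of _ _ "\<lambda>x. x * _"])
    finally show ?thesis
      unfolding eq using True fin by auto
  next
    case False
    then show ?thesis
      unfolding chains_from_Suc chain_weight.simps by (simp only: if_False) simp
  qed
qed

lemma based_chains_eq: "based_chains (Suc n) u = (\<Union>a\<in>{1..u}. chains_from n (0, a) u)"
proof (intro set_eqI iffI)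
  fix xs assume xs: "xs \<in> based_chains (Suc n) u"
  then obtain a ys where c: "xs = (0, a) # ys"
    by (auto simp: based_chains_def length_Suc_conv)
  have "xs \<in> chains_from n (0, a) u" "a \<in> {1..u}"
    using xs by (auto simp: c based_chains_def chains_from_def chain_def total_length_def Suc_le_eq)
  then show "xs \<in> (\<Union>a\<in>{1..u}. chains_from n (0, a) u)" by blast
qed (auto simp: based_chains_def chains_from_def)

lemma finite_based_chains: "finite (based_chains (Suc n) u)"
  unfolding based_chains_eq using card_chains_from by auto

section \<open>The generating function of chains\<close>

unbundle fps_syntax

text \<open>The series \<open>1 / (1 - X)\<close>, given by its coefficients because the natural numbers have no
  additive inverses. The counts below never need them, so all coefficients are natural numbers.\<close>

definition geo :: "nat fps" where
  "geo = Abs_fps (\<lambda>_. 1)"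

lemma geo_power_nth: "(geo ^ Suc c) $ j = (c + j) choose j"
proof (induction c arbitrary: j)
  case 0
  then show ?case by (simp add: geo_def)
next
  case (Suc c)
  have "(geo ^ Suc (Suc c)) $ j = (\<Sum>i=0..j. (geo ^ Suc c) $ i)"
    by (subst power_Suc2) (simp add: fps_mult_nth geo_def)
  also have "\<dots> = (\<Sum>i\<le>j. (c + i) choose i)"
    unfolding Suc.IH atMost_atLeast0 ..
  also have "\<dots> = (Suc c + j) choose j"
    using sum_choose_lower[of c j] by simp
  finally show ?case .
qed

lemma one_plus_X_power_nth: "((1 + fps_X :: nat fps) ^ b) $ j = b choose j"
proof (induction b arbitrary: j)
  case 0
  then show ?case by (cases j) auto
next
  case (Suc b)
  then show ?case by (cases j) (auto simp: distrib_right)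
qed

text \<open>The entries of the transfer matrix: the coefficients \<open>1\<close>, \<open>a - 1\<close>, \<open>a\<close> and \<open>a (a - 1)\<close> come from
  expanding \<open>(a + b - 1)\<close> and \<open>a (a + b - 1)\<close> in powers of \<open>b\<close>.\<close>

lemma series_one: "Abs_fps (\<lambda>a. if a = 0 then 0 else 1) = fps_X * geo"
  by (rule fps_ext) (simp add: geo_def)

lemma geo_squared_nth: "(geo ^ 2) $ j = Suc j"
  using geo_power_nth[of 1 j] by (simp add: numeral_2_eq_2)

lemma geo_cubed_nth: "(geo ^ 3) $ j = (j + 2) choose 2"
  using geo_power_nth[of 2 j] binomial_symmetric[of 2 "j + 2"]
  by (simp add: eval_nat_numeral)

lemma series_pred: "Abs_fps (\<lambda>a. a - 1) = fps_X ^ 2 * geo ^ 2"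
  by (rule fps_ext) (auto simp: fps_X_power_mult_nth geo_squared_nth)

lemma series_id: "Abs_fps (\<lambda>a. a) = fps_X * geo ^ 2"
  by (rule fps_ext) (auto simp: geo_squared_nth)

lemma series_falling: "Abs_fps (\<lambda>a. a * (a - 1)) = fps_X ^ 2 * geo ^ 3 + fps_X ^ 2 * geo ^ 3"
proof (rule fps_ext)
  fix a :: nat
  have "even (a * (a - 1))"
    by (cases a) auto
  then have "a * (a - 1) = (a choose 2) + (a choose 2)"
    unfolding choose_two by presburger
  then show "Abs_fps (\<lambda>a. a * (a - 1)) $ a = (fps_X ^ 2 * geo ^ 3 + fps_X ^ 2 * geo ^ 3) $ a"
    by (cases "a < 2") (auto simp: fps_X_power_mult_nth geo_cubed_nth binomial_eq_0
        dest!: le_Suc_ex simp: not_less)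
qed

text \<open>Homogeneous Fibonacci polynomials: for \<open>p = q = 1\<close> this sums a shallow diagonal of Pascal's
  triangle to a Fibonacci number. The binomial coefficient vanishes for \<open>2 * i > n\<close>, where the
  exponent \<open>n - 2 * i\<close> is truncated.\<close>

definition fibonacci_poly :: "'a::comm_semiring_1 \<Rightarrow> 'a \<Rightarrow> nat \<Rightarrow> 'a" where
  "fibonacci_poly p q n = (\<Sum>i\<le>n. of_nat ((n - i) choose i) * q ^ i * p ^ (n - 2 * i))"

text \<open>Pascal's rule applied to each summand: one part keeps \<open>i\<close> and belongs to index \<open>n + 1\<close>, the
  other lowers \<open>i\<close> and belongs to index \<open>n\<close>.\<close>

lemma fibonacci_poly_rec:
  "fibonacci_poly p q (Suc (Suc n)) = p * fibonacci_poly p q (Suc n) + q * fibonacci_poly p q n"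
proof -
  let ?t = "\<lambda>n i. of_nat ((n - i) choose i) * q ^ i * p ^ (n - 2 * i)"
  have split: "?t (Suc (Suc n)) (Suc i) = p * ?t (Suc n) (Suc i) + q * ?t n i" if "i \<le> n" for i
  proof -
    have eq: "Suc (Suc n) - Suc i = Suc (n - i)"
      using that by simp
    have p: "of_nat ((n - i) choose Suc i) * p ^ (n - 2 * i)
        = of_nat ((n - i) choose Suc i) * (p * p ^ (Suc n - 2 * Suc i))"
    proof (cases "Suc i \<le> n - i")
      case True
      then have "n - 2 * i = Suc (Suc n - 2 * Suc i)" by simp
      then show ?thesis by simp
    qed (simp add: binomial_eq_0)
    have "?t (Suc (Suc n)) (Suc i) = q * ?t n i
        + q ^ Suc i * (of_nat ((n - i) choose Suc i) * p ^ (n - 2 * i))"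
      by (simp only: eq binomial_Suc_Suc of_nat_add) (simp add: algebra_simps)
    also have "q ^ Suc i * (of_nat ((n - i) choose Suc i) * p ^ (n - 2 * i)) = p * ?t (Suc n) (Suc i)"
      by (simp only: p) (simp add: algebra_simps)
    finally show ?thesis by (simp add: add.commute)
  qed
  have "fibonacci_poly p q (Suc (Suc n)) = ?t (Suc (Suc n)) 0 + (\<Sum>i\<le>Suc n. ?t (Suc (Suc n)) (Suc i))"
    unfolding fibonacci_poly_def by (rule sum.atMost_Suc_shift)
  also have "(\<Sum>i\<le>Suc n. ?t (Suc (Suc n)) (Suc i)) = (\<Sum>i\<le>n. ?t (Suc (Suc n)) (Suc i))"
    by simp
  also have "\<dots> = (\<Sum>i\<le>n. p * ?t (Suc n) (Suc i) + q * ?t n i)"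
    by (intro sum.cong refl split) simp
  also have "?t (Suc (Suc n)) 0 + \<dots> =
      p * (?t (Suc n) 0 + (\<Sum>i\<le>n. ?t (Suc n) (Suc i))) + q * (\<Sum>i\<le>n. ?t n i)"
    by (simp add: sum.distrib sum_distrib_left algebra_simps)
  also have "?t (Suc n) 0 + (\<Sum>i\<le>n. ?t (Suc n) (Suc i)) = fibonacci_poly p q (Suc n)"
    unfolding fibonacci_poly_def by (rule sum.atMost_Suc_shift[symmetric])
  finally show ?thesis unfolding fibonacci_poly_def .
qed

text \<open>The generating function by total length of chains weighted by \<open>h\<close> of the first length. The
  series \<open>F\<close> and \<open>G\<close> of the transfer matrix are the cases \<open>h = 1\<close> and \<open>h = id\<close>.\<close>

definition moment :: "(nat \<Rightarrow> nat) \<Rightarrow> nat \<Rightarrow> nat fps" where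
  "moment h n = Abs_fps (\<lambda>u. \<Sum>a=1..u. h a * chain_weight n a u)"

lemma moment_0: "moment h 0 = Abs_fps (\<lambda>a. if a = 0 then 0 else h a)"
proof (rule fps_ext)
  fix u
  have "(\<Sum>a=1..u. h a * chain_weight 0 a u) = (\<Sum>a=1..u. if a = u then h a else 0)"
    by (intro sum.cong) auto
  then show "moment h 0 $ u = Abs_fps (\<lambda>a. if a = 0 then 0 else h a) $ u"
    by (simp add: moment_def)
qed

text \<open>Splitting the factor \<open>a + b - 1\<close> as \<open>(a - 1) + b\<close> separates the first length from the rest of
  the chain, so the sum over \<open>a\<close> becomes a product of power series.\<close>

lemma moment_Suc:
  "moment h (Suc n) = Abs_fps (\<lambda>a. h a * (a - 1)) * moment (\<lambda>_. 1) n
     + Abs_fps (\<lambda>a. if a = 0 then 0 else h a) * moment (\<lambda>a. a) n"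
proof (rule fps_ext)
  fix u
  let ?w = "chain_weight n"
  have "moment h (Suc n) $ u
      = (\<Sum>a=1..u. h a * (a - 1) * (\<Sum>b=1..u - a. 1 * ?w b (u - a))
          + (if a = 0 then 0 else h a) * (\<Sum>b=1..u - a. b * ?w b (u - a)))"
    unfolding moment_def fps_nth_Abs_fps
  proof (rule sum.cong[OF refl])
    fix a assume a: "a \<in> {1..u}"
    have "(\<Sum>b=1..u - a. (a + b - 1) * ?w b (u - a))
        = (\<Sum>b=1..u - a. (a - 1) * (1 * ?w b (u - a)) + b * ?w b (u - a))"
    proof (rule sum.cong[OF refl])
      fix b
      have "a + b - 1 = (a - 1) + b" using a by simp
      then show "(a + b - 1) * ?w b (u - a) = (a - 1) * (1 * ?w b (u - a)) + b * ?w b (u - a)"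
        by (simp only: add_mult_distrib mult_1)
    qed
    then have "chain_weight (Suc n) a u
        = (a - 1) * (\<Sum>b=1..u - a. 1 * ?w b (u - a)) + (\<Sum>b=1..u - a. b * ?w b (u - a))"
      using a by (simp only: sum.distrib sum_distrib_left[symmetric]) simp
    then show "h a * chain_weight (Suc n) a u = h a * (a - 1) * (\<Sum>b=1..u - a. 1 * ?w b (u - a))
        + (if a = 0 then 0 else h a) * (\<Sum>b=1..u - a. b * ?w b (u - a))"
      using a by (simp only: distrib_left mult.assoc) simp
  qed
  also have "\<dots> = (\<Sum>a=0..u. h a * (a - 1) * (\<Sum>b=1..u - a. 1 * ?w b (u - a))
          + (if a = 0 then 0 else h a) * (\<Sum>b=1..u - a. b * ?w b (u - a)))"
    by (simp add: sum.atLeast_Suc_atMost[of 0 u])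
  finally show "moment h (Suc n) $ u = (Abs_fps (\<lambda>a. h a * (a - 1)) * moment (\<lambda>_. 1) n
     + Abs_fps (\<lambda>a. if a = 0 then 0 else h a) * moment (\<lambda>a. a) n) $ u"
    by (simp add: fps_mult_nth moment_def sum.distrib)
qed

text \<open>Eliminating \<open>G\<close> from the transfer matrix is the theorem of Cayley and Hamilton for a two by two
  matrix. Since the determinant is minus one half of the product of the off-diagonal entries, it can
  be written without subtraction, hence over the natural numbers.\<close>

lemma chain_series:
  "moment (\<lambda>_. 1) n = fps_X ^ Suc n * geo ^ Suc (2 * n) * fibonacci_poly (1 + fps_X) fps_X n"
proof -
  let ?F = "moment (\<lambda>_. 1)" and ?G = "moment (\<lambda>a. a)"
  have id: "Abs_fps (\<lambda>a. if a = 0 then 0 else a) = fps_X * geo ^ 2"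
    using series_id by (auto simp: fps_eq_iff)
  have F: "?F (Suc n) = fps_X ^ 2 * geo ^ 2 * ?F n + fps_X * geo * ?G n" for n
    unfolding moment_Suc[of "\<lambda>_. 1"] mult_1 series_pred series_one ..
  have G: "?G (Suc n) = (fps_X ^ 2 * geo ^ 3 + fps_X ^ 2 * geo ^ 3) * ?F n + fps_X * geo ^ 2 * ?G n" for n
    unfolding moment_Suc[of "\<lambda>a. a"] series_falling id ..
  have rec: "?F (Suc (Suc n)) = fps_X * geo ^ 2 * (1 + fps_X) * ?F (Suc n) + fps_X ^ 3 * geo ^ 4 * ?F n" for n
  proof -
    \<comment> \<open>Of the off-diagonal product \<open>2 X\<^sup>3 g\<^sup>4\<close>, one half remains and the other half completes \<open>F\<^sub>n\<^sub>+\<^sub>1\<close>.\<close>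
    have "?F (Suc (Suc n)) = fps_X ^ 2 * geo ^ 2 * ?F (Suc n) + fps_X ^ 3 * geo ^ 4 * ?F n
        + fps_X * geo ^ 2 * (fps_X ^ 2 * geo ^ 2 * ?F n + fps_X * geo * ?G n)"
      unfolding F[of "Suc n"] G[of n]
      by (simp add: algebra_simps power2_eq_square power3_eq_cube power4_eq_xxxx)
    also have "\<dots> = fps_X ^ 2 * geo ^ 2 * ?F (Suc n) + fps_X ^ 3 * geo ^ 4 * ?F n
        + fps_X * geo ^ 2 * ?F (Suc n)"
      by (simp only: F[of n])
    also have "\<dots> = fps_X * geo ^ 2 * (1 + fps_X) * ?F (Suc n) + fps_X ^ 3 * geo ^ 4 * ?F n"
      by (simp add: algebra_simps power2_eq_square)
    finally show ?thesis .
  qed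
  have F0: "?F 0 = fps_X * geo"
    unfolding moment_0 series_one ..
  have G0: "?G 0 = fps_X * geo ^ 2"
    unfolding moment_0 id ..
  show ?thesis
  proof (induction n rule: induct_nat_012)
    case 0
    show ?case using F0 by (simp add: fibonacci_poly_def)
  next
    case 1
    show ?case unfolding F[of 0] F0 G0
      by (simp add: fibonacci_poly_def algebra_simps power2_eq_square)
  next
    case (ge2 n)
    show ?case
      unfolding rec ge2 fibonacci_poly_rec
      by (simp add: algebra_simps power2_eq_square power3_eq_cube power4_eq_xxxx)
  qed
qed

lemma binom_of_nat: "binom (int n) (int k) = n choose k"
  by (simp add: binom_def)

text \<open>The summand of index \<open>i\<close> in the Fibonacci polynomial is multiplied by the power of \<open>geo\<close>, and the
  index \<open>j\<close> of \<open>alpha\<close> is the exponent taken from that power; \<open>1 + X\<close> has to supply the remaining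
  \<open>u - (n + 1 + i + j)\<close>.\<close>

lemma series_nth_eq_alpha:
  "(fps_X ^ Suc n * geo ^ Suc (2 * n) * fibonacci_poly (1 + fps_X) fps_X n) $ u
     = alpha (int (Suc n)) (int u)"
proof -
  let ?c = "\<lambda>i j. if Suc n + i + j \<le> u then (n - 2 * i) choose (u - (Suc n + i + j)) else 0"
  have term_nth: "(fps_X ^ (Suc n + i) * geo ^ Suc (2 * n) * (1 + fps_X) ^ (n - 2 * i)) $ u
      = (\<Sum>j\<le>u. ((2 * n + j) choose j) * ?c i j)" for i
  proof -
    have "(fps_X ^ (Suc n + i) * geo ^ Suc (2 * n) * (1 + fps_X) ^ (n - 2 * i)) $ u
       = (geo ^ Suc (2 * n) * (fps_X ^ (Suc n + i) * (1 + fps_X) ^ (n - 2 * i))) $ u"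
      by (simp only: mult.commute mult.left_commute)
    also have "\<dots> = (\<Sum>j\<le>u. ((2 * n + j) choose j) * ?c i j)"
      unfolding fps_mult_nth[of "geo ^ Suc (2 * n)"] atMost_atLeast0 geo_power_nth
        fps_X_power_mult_nth one_plus_X_power_nth
      by (intro sum.cong refl) (auto simp: diff_diff_add add.commute)
    finally show ?thesis .
  qed
  have summand: "alpha_term (int (Suc n)) (int u) (i, j)
      = ((n - i) choose i) * ((2 * n + j) choose j) * ?c i j" if "i \<le> n" for i j
  proof (cases "2 * i \<le> n")
    case True
    have 1: "int (Suc n) - int i - 1 = int (n - i)" "2 * int (Suc n) + int j - 2 = int (2 * n + j)"
      "int (Suc n) - 2 * int i - 1 = int (n - 2 * i)"
      using that True by auto
    have 2: "binom (int (n - 2 * i)) (int u - int (Suc n) - int i - int j) = ?c i j"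
    proof (cases "Suc n + i + j \<le> u")
      case True
      then have "int u - int (Suc n) - int i - int j = int (u - (Suc n + i + j))" by simp
      then show ?thesis using True by (simp only: binom_of_nat) simp
    qed (simp add: binom_def)
    show ?thesis
      unfolding alpha_term_def prod.case 1 2 binom_of_nat ..
  next
    case False
    then show ?thesis using that by (simp add: alpha_term_def binom_def binomial_eq_0)
  qed
  have "alpha (int (Suc n)) (int u) = (\<Sum>p\<in>{..n} \<times> {..u}. alpha_term (int (Suc n)) (int u) p)"
    unfolding alpha_def
  proof (rule Sum_any.expand_superset)
    show "{p. alpha_term (int (Suc n)) (int u) p \<noteq> 0} \<subseteq> {..n} \<times> {..u}"
      by (auto simp: alpha_term_def binom_def split: if_splits)
  qed simp
  also have "\<dots> = (\<Sum>i\<le>n. \<Sum>j\<le>u. alpha_term (int (Suc n)) (int u) (i, j))"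
    by (simp add: sum.cartesian_product)
  also have "\<dots> = (\<Sum>i\<le>n. ((n - i) choose i) * (\<Sum>j\<le>u. ((2 * n + j) choose j) * ?c i j))"
    unfolding sum_distrib_left by (intro sum.cong refl) (simp only: summand atMost_iff mult.assoc)
  also have "\<dots> = (\<Sum>i\<le>n. of_nat ((n - i) choose i) * (fps_X ^ (Suc n + i) * geo ^ Suc (2 * n) * (1 + fps_X) ^ (n - 2 * i))) $ u"
    unfolding fps_sum_nth
    by (intro sum.cong refl) (simp only: term_nth fps_of_nat[symmetric] fps_mult_left_const_nth of_nat_id)
  also have "(\<Sum>i\<le>n. of_nat ((n - i) choose i) * (fps_X ^ (Suc n + i) * geo ^ Suc (2 * n) * (1 + fps_X) ^ (n - 2 * i)))
     = fps_X ^ Suc n * geo ^ Suc (2 * n) * fibonacci_poly (1 + fps_X) fps_X n"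
    unfolding fibonacci_poly_def sum_distrib_left power_add
    by (intro sum.cong refl) (simp only: ac_simps)
  finally show ?thesis ..
qed

lemma card_based_chains: "card (based_chains (Suc n) u) = alpha (int (Suc n)) (int u)"
proof -
  have "card (based_chains (Suc n) u) = (\<Sum>a=1..u. card (chains_from n (0, a) u))"
    unfolding based_chains_eq
    using card_chains_from by (intro card_UN_disjoint) (auto simp: chains_from_def)
  also have "\<dots> = moment (\<lambda>_. 1) n $ u"
    by (simp add: card_chains_from moment_def)
  also have "\<dots> = alpha (int (Suc n)) (int u)"
    unfolding chain_series series_nth_eq_alpha ..
  finally show ?thesis .
qed

section \<open>Stacks of boxes\<close>

text \<open>The polycube whose layer at \<open>x\<close> is the product of the intervals of index \<open>x\<close> in \<open>A\<close> and \<open>B\<close>.\<close>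

definition stack :: "(int \<times> nat) list \<Rightarrow> (int \<times> nat) list \<Rightarrow> cell set" where
  "stack A B = {(x, y, z). 0 \<le> x \<and> x < int (length A) \<and>
     y \<in> extent (A ! nat x) \<and> z \<in> extent (B ! nat x)}"

lemma chain_nth_pos: "chain xs \<Longrightarrow> t < length xs \<Longrightarrow> 0 < snd (xs ! t)"
  by (simp add: chain_def)

lemma chain_nth_meet:
  "chain xs \<Longrightarrow> Suc t < length xs \<Longrightarrow> extent (xs ! t) \<inter> extent (xs ! Suc t) \<noteq> {}"
  by (simp add: chain_def successively_conv_nth)

lemma finite_extent [simp]: "finite (extent I)"
  by (simp add: extent_def)

lemma card_extent [simp]: "card (extent I) = snd I"
  by (simp add: extent_def)

lemma extent_nonempty_iff [simp]: "extent I = {} \<longleftrightarrow> snd I = 0"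
  by (simp add: extent_def)

lemma left_end_in_extent: "0 < snd I \<Longrightarrow> fst I \<in> extent I"
  by (simp add: extent_def)

lemma extent_inject:
  assumes "0 < snd I" "0 < snd J" "extent I = extent J"
  shows "I = J"
  using assms by (auto simp: extent_def atLeastLessThan_eq_iff prod_eq_iff)

section \<open>Connectivity\<close>

definition linked :: "cell set \<Rightarrow> (cell \<times> cell) set" where
  "linked P = {(a, b). a \<in> P \<and> b \<in> P \<and> share_face a b}\<^sup>*"

lemma share_face_sym: "share_face a b \<longleftrightarrow> share_face b a"
  by (cases a; cases b) (auto simp: abs_minus_commute)

lemma linked_sym: "(a, b) \<in> linked P \<Longrightarrow> (b, a) \<in> linked P"
  unfolding linked_def
  by (rule symD[OF sym_rtrancl]) (auto intro!: symI simp: share_face_sym)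

lemma linked_refl [simp]: "(a, a) \<in> linked P"
  by (simp add: linked_def)

lemma linked_trans: "(a, b) \<in> linked P \<Longrightarrow> (b, c) \<in> linked P \<Longrightarrow> (a, c) \<in> linked P"
  unfolding linked_def by (rule rtrancl_trans)

lemma linked_step: "a \<in> P \<Longrightarrow> b \<in> P \<Longrightarrow> share_face a b \<Longrightarrow> (a, b) \<in> linked P"
  unfolding linked_def by blast

lemma face_connectedI:
  assumes "\<And>c. c \<in> P \<Longrightarrow> (c, r) \<in> linked P"
  shows "face_connected P"
  unfolding face_connected_def linked_def[symmetric]
  by (intro ballI linked_trans[OF assms linked_sym[OF assms]])

lemma segment_linked:
  fixes lo hi :: int
  assumes "lo \<le> hi" "\<And>t. share_face (f t) (f (t + 1))" "\<And>t. lo \<le> t \<Longrightarrow> t \<le> hi \<Longrightarrow> f t \<in> P"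
  shows "(f lo, f hi) \<in> linked P"
  using assms(1,3)
proof (induction hi rule: int_ge_induct)
  case (step i)
  then have "(f lo, f i) \<in> linked P" by simp
  moreover have "(f i, f (i + 1)) \<in> linked P"
    using step by (intro linked_step assms(2)) auto
  ultimately show ?case by (rule linked_trans)
qed simp

lemma interval_linked:
  assumes "a \<in> extent I" "b \<in> extent I" "\<And>t. share_face (f t) (f (t + 1))"
    "\<And>t. t \<in> extent I \<Longrightarrow> f t \<in> P"
  shows "(f a, f b) \<in> linked P"
proof (cases "a \<le> b")
  case True
  then show ?thesis using assms by (intro segment_linked) (auto simp: extent_def)
next
  case False
  then have "(f b, f a) \<in> linked P"
    using assms by (intro segment_linked) (auto simp: extent_def)
  then show ?thesis by (rule linked_sym)
qed

lemma box_linked: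
  assumes "y \<in> extent I" "y' \<in> extent I" "z \<in> extent J" "z' \<in> extent J"
    "{x} \<times> extent I \<times> extent J \<subseteq> P"
  shows "((x, y, z), (x, y', z')) \<in> linked P"
proof (rule linked_trans)
  show "((x, y, z), (x, y', z)) \<in> linked P"
    using assms by (intro interval_linked[of y I y' "\<lambda>t. (x, t, z)"]) auto
  show "((x, y', z), (x, y', z')) \<in> linked P"
    using assms by (intro interval_linked[of z J z' "\<lambda>t. (x, y', t)"]) auto
qed

lemma plateau_box:
  assumes "0 < snd I" "0 < snd J"
  shows "plateau ({x} \<times> extent I \<times> extent J)"
proof -
  let ?P = "{x} \<times> extent I \<times> extent J"
  have ne: "extent I \<noteq> {}" "extent J \<noteq> {}" using assms by auto
  have "face_connected ?P"
  proof (rule face_connectedI)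
    fix c assume "c \<in> ?P"
    then obtain y z where "c = (x, y, z)" "y \<in> extent I" "z \<in> extent J" by blast
    then show "(c, (x, fst I, fst J)) \<in> linked ?P"
      using box_linked[of y I "fst I" z J "fst J" x ?P] assms by (simp add: left_end_in_extent)
  qed
  moreover have "fst ` ?P = {x}"
    using ne by simp
  ultimately have "stratum ?P"
    using ne by (simp add: stratum_def polycube_def width_def)
  moreover have "?P = {x} \<times> {fst I..<fst I + int (snd I)} \<times> {fst J..<fst J + int (snd J)}"
    by (simp add: extent_def)
  ultimately show ?thesis
    unfolding plateau_def by (intro conjI exI)
qed

text \<open>A path from the left of the plane between \<open>x\<close> and \<open>x + 1\<close> to its right has a step through that
  plane. This gives both that a polycube leaves no layer empty and that consecutive layers overlap.\<close>

lemma crossing: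
  assumes "face_connected P" "c \<in> P" "d \<in> P" "fst c \<le> x" "x < fst d"
  shows "\<exists>y z. (x, y, z) \<in> P \<and> (x + 1, y, z) \<in> P"
proof -
  have "(c, d) \<in> {(a, b). a \<in> P \<and> b \<in> P \<and> share_face a b}\<^sup>*"
    using assms by (simp add: face_connected_def)
  then show ?thesis using assms(5)
  proof (induction rule: rtrancl_induct)
    case base
    then show ?case using assms(4) by simp
  next
    case (step e d)
    show ?case
    proof (cases "x < fst e")
      case False
      obtain x1 y1 z1 x2 y2 z2 where e: "e = (x1, y1, z1)" "d = (x2, y2, z2)"
        by (cases e; cases d) auto
      have "\<bar>x1 - x2\<bar> + \<bar>y1 - y2\<bar> + \<bar>z1 - z2\<bar> = 1" "x1 \<le> x" "x < x2"
        using step.hyps(2) False step.prems by (simp_all add: e)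
      then have "x1 = x \<and> x2 = x + 1 \<and> y1 = y2 \<and> z1 = z2" by arith
      moreover have "e \<in> P" "d \<in> P" using step.hyps(2) by simp_all
      ultimately show ?thesis unfolding e by blast
    qed (use step.IH in blast)
  qed
qed

section \<open>Stacks are plateau polycubes\<close>

context
  fixes A B :: "(int \<times> nat) list"
  assumes A: "chain A" and B: "chain B" and len: "length A = length B" and ne: "A \<noteq> []"
begin

lemma layer_stack:
  assumes "t < length A"
  shows "layer (stack A B) (int t) = {int t} \<times> extent (A ! t) \<times> extent (B ! t)"
  using assms by (auto simp: layer_def stack_def)

lemma extents_nonempty:
  assumes "t < length A"
  shows "extent (A ! t) \<noteq> {}" "extent (B ! t) \<noteq> {}"
  using chain_nth_pos[OF A, of t] chain_nth_pos[OF B, of t] assms len by simp_all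

lemma fst_stack: "fst ` stack A B = {0..<int (length A)}"
proof (intro equalityI subsetI)
  fix x assume "x \<in> {0..<int (length A)}"
  moreover from this obtain y z where "y \<in> extent (A ! nat x)" "z \<in> extent (B ! nat x)"
    using extents_nonempty[of "nat x"] by fastforce
  ultimately have "(x, y, z) \<in> stack A B" by (simp add: stack_def)
  then show "x \<in> fst ` stack A B" by force
qed (auto simp: stack_def)

lemma width_stack: "width (stack A B) = int (length A)"
proof -
  let ?n = "int (length A)"
  have "0 < ?n" using ne by simp
  then have "Max {0..<?n} = ?n - 1" "Min {0..<?n} = 0"
    by (auto intro!: Max_eqI Min_eqI)
  then show ?thesis by (simp add: width_def fst_stack)
qed

text \<open>Projecting a layer along one lateral direction leaves the interval of the other direction.\<close>

lemma card_stack_projections: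
  "card ((\<lambda>(x, y, z). (x, y)) ` stack A B) = total_length A"
  "card ((\<lambda>(x, y, z). (x, z)) ` stack A B) = total_length B"
proof -
  have card_Sigma: "card (SIGMA x:{0..<int (length xs)}. extent (xs ! nat x)) = total_length xs"
    for xs :: "(int \<times> nat) list"
  proof -
    have "card (SIGMA x:{0..<int (length xs)}. extent (xs ! nat x))
        = (\<Sum>x\<in>{0..<int (length xs)}. snd (xs ! nat x))"
      by (subst card_SigmaI) auto
    also have "\<dots> = (\<Sum>t\<in>{0..<length xs}. snd (xs ! t))"
      by (rule sum.reindex_bij_witness[of _ int nat]) auto
    finally show ?thesis by (simp add: total_length_def sum_list_sum_nth)
  qed
  have "(\<lambda>(x, y, z). (x, y)) ` stack A B = (SIGMA x:{0..<int (length A)}. extent (A ! nat x))"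
  proof (intro equalityI subsetI)
    fix p assume "p \<in> (SIGMA x:{0..<int (length A)}. extent (A ! nat x))"
    moreover from this obtain z where "z \<in> extent (B ! nat (fst p))"
      using extents_nonempty[of "nat (fst p)"] by fastforce
    ultimately show "p \<in> (\<lambda>(x, y, z). (x, y)) ` stack A B"
      by (auto simp: stack_def image_iff)
  qed (auto simp: stack_def)
  then show "card ((\<lambda>(x, y, z). (x, y)) ` stack A B) = total_length A"
    by (simp add: card_Sigma)
  have "(\<lambda>(x, y, z). (x, z)) ` stack A B = (SIGMA x:{0..<int (length B)}. extent (B ! nat x))"
  proof (intro equalityI subsetI)
    fix p assume "p \<in> (SIGMA x:{0..<int (length B)}. extent (B ! nat x))"
    moreover from this obtain y where "y \<in> extent (A ! nat (fst p))"
      using extents_nonempty[of "nat (fst p)"] len by fastforce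
    ultimately show "p \<in> (\<lambda>(x, y, z). (x, z)) ` stack A B"
      using len by (auto simp: stack_def image_iff)
  qed (auto simp: stack_def len)
  then show "card ((\<lambda>(x, y, z). (x, z)) ` stack A B) = total_length B"
    by (simp add: card_Sigma)
qed

lemma lateral_area_stack: "lateral_area (stack A B) = total_length A + total_length B"
  by (simp add: lateral_area_def card_stack_projections)

text \<open>All cells are linked to one cell of the first layer: within a layer a cell can be moved to a
  common point of the intervals of this layer and the preceding one, and from there it steps down.\<close>

lemma face_connected_stack: "face_connected (stack A B)"
proof -
  obtain y0 z0 where root: "y0 \<in> extent (A ! 0)" "z0 \<in> extent (B ! 0)"
    using extents_nonempty[of 0] ne by (metis ex_in_conv length_greater_0_conv)
  have box: "{int t} \<times> extent (A ! t) \<times> extent (B ! t) \<subseteq> stack A B" if "t < length A" for t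
    using that by (auto simp: stack_def)
  have to_root: "((int t, y, z), (0, y0, z0)) \<in> linked (stack A B)"
    if "t < length A" "y \<in> extent (A ! t)" "z \<in> extent (B ! t)" for t y z
    using that
  proof (induction t arbitrary: y z)
    case 0
    then show ?case
      using box_linked[OF 0(2) root(1) 0(3) root(2), of 0] box[of 0] by simp
  next
    case (Suc t)
    obtain y1 z1 where y1: "y1 \<in> extent (A ! t)" "y1 \<in> extent (A ! Suc t)"
      and z1: "z1 \<in> extent (B ! t)" "z1 \<in> extent (B ! Suc t)"
      using chain_nth_meet[OF A, of t] chain_nth_meet[OF B, of t] Suc.prems(1) len by auto
    have "((int (Suc t), y, z), (int (Suc t), y1, z1)) \<in> linked (stack A B)"
      using box_linked[OF Suc.prems(2) y1(2) Suc.prems(3) z1(2)] box Suc.prems(1) by blast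
    moreover have "((int (Suc t), y1, z1), (int t, y1, z1)) \<in> linked (stack A B)"
      using y1 z1 Suc.prems(1) by (intro linked_step) (auto simp: stack_def nat_add_distrib)
    moreover have "((int t, y1, z1), (0, y0, z0)) \<in> linked (stack A B)"
      using Suc.IH y1(1) z1(1) Suc.prems(1) by simp
    ultimately show ?case using linked_trans by blast
  qed
  show ?thesis
  proof (rule face_connectedI)
    fix c assume "c \<in> stack A B"
    then obtain x y z where c: "c = (x, y, z)" "0 \<le> x" "nat x < length A"
      "y \<in> extent (A ! nat x)" "z \<in> extent (B ! nat x)"
      by (auto simp: stack_def)
    then show "(c, (0, y0, z0)) \<in> linked (stack A B)"
      using to_root[of "nat x" y z] by simp
  qed
qed

lemma plateau_polycube_stack: "plateau_polycube (stack A B)"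
proof -
  have "stack A B \<subseteq> (\<Union>t<length A. layer (stack A B) (int t))"
  proof
    fix c assume c: "c \<in> stack A B"
    then have "0 \<le> fst c" "nat (fst c) < length A" by (auto simp: stack_def)
    then show "c \<in> (\<Union>t<length A. layer (stack A B) (int t))"
      using c by (intro UN_I[of "nat (fst c)"]) (auto simp: layer_def)
  qed
  moreover have "finite (\<Union>t<length A. layer (stack A B) (int t))"
    by (intro finite_UN_I) (auto simp: layer_stack)
  ultimately have "finite (stack A B)" by (rule finite_subset)
  moreover have "fst ` stack A B \<noteq> {}"
    unfolding fst_stack using ne by simp
  moreover have "plateau (layer (stack A B) x)" if "x \<in> fst ` stack A B" for x
  proof -
    have x: "0 \<le> x" "nat x < length A" using that by (auto simp: fst_stack)
    then have "layer (stack A B) x = {x} \<times> extent (A ! nat x) \<times> extent (B ! nat x)"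
      using layer_stack[of "nat x"] by simp
    then show ?thesis
      using plateau_box chain_nth_pos[OF A] chain_nth_pos[OF B] x len by simp
  qed
  ultimately show ?thesis
    using face_connected_stack by (simp add: plateau_polycube_def polycube_def)
qed

end

section \<open>Plateau polycubes are stacks\<close>

lemma plateauE:
  assumes "plateau S"
  obtains x I J where "S = {x} \<times> extent I \<times> extent J" "0 < snd I" "0 < snd J"
proof -
  obtain x y z b c where S: "S = {x} \<times> {y..<y + int b} \<times> {z..<z + int c}"
    using assms unfolding plateau_def by auto
  moreover have "S \<noteq> {}"
    using assms by (simp add: plateau_def stratum_def polycube_def)
  ultimately have "0 < b" "0 < c" by auto
  then show ?thesis
    using that[of x "(y, b)" "(z, c)"] S by (simp add: extent_def)
qed

text \<open>The chains are the lateral intervals of the successive layers, shifted so that the first layer has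
  a corner at the origin.\<close>

lemma plateau_polycube_cases:
  assumes P: "plateau_polycube P" and k: "width P = int k"
  obtains A B v where "chain A" "chain B" "length A = k" "length B = k"
    "fst (hd A) = 0" "fst (hd B) = 0" "P = (+) v ` stack A B"
proof -
  have fin: "finite P" and ne: "P \<noteq> {}" and conn: "face_connected P"
    using P by (auto simp: plateau_polycube_def polycube_def)
  define x0 where "x0 = Min (fst ` P)"
  have Max: "Max (fst ` P) = x0 + int k - 1"
    using k by (simp add: width_def x0_def)
  have lo: "x0 \<in> fst ` P"
    unfolding x0_def using fin ne by (intro Min_in) auto
  have hi: "x0 + int k - 1 \<in> fst ` P"
    unfolding Max[symmetric] using fin ne by (intro Max_in) auto
  have range: "x0 \<le> x \<and> x \<le> x0 + int k - 1" if "x \<in> fst ` P" for x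
    using that fin Min_le[of "fst ` P" x] Max_ge[of "fst ` P" x] by (simp add: Max x0_def)
  have kpos: "0 < k" using range[OF lo] by simp
  have cross: "\<exists>y z. (x, y, z) \<in> P \<and> (x + 1, y, z) \<in> P" if "x0 \<le> x" "x < x0 + int k - 1" for x
  proof -
    obtain c d where "c \<in> P" "fst c = x0" "d \<in> P" "fst d = x0 + int k - 1"
      using lo hi by (auto simp: image_iff)
    then show ?thesis using that by (intro crossing[OF conn, of c d]) auto
  qed
  have all: "x \<in> fst ` P" if "x0 \<le> x" "x < x0 + int k" for x
  proof (cases "x = x0 + int k - 1")
    case False
    then show ?thesis using cross[of x] that by force
  qed (use hi in simp)
  have "\<exists>I J. layer P x = {x} \<times> extent I \<times> extent J \<and> 0 < snd I \<and> 0 < snd J"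
    if x: "x \<in> fst ` P" for x
  proof -
    obtain x' I J where eq: "layer P x = {x'} \<times> extent I \<times> extent J" "0 < snd I" "0 < snd J"
      using plateauE P x unfolding plateau_polycube_def by metis
    then have "(x', fst I, fst J) \<in> layer P x" by (simp add: left_end_in_extent)
    then have "x' = x" by (simp add: layer_def)
    then show ?thesis using eq by blast
  qed
  then obtain I J where IJ: "\<And>x. x \<in> fst ` P \<Longrightarrow>
      layer P x = {x} \<times> extent (I x) \<times> extent (J x) \<and> 0 < snd (I x) \<and> 0 < snd (J x)"
    by metis
  have mem: "(x, y, z) \<in> P \<longleftrightarrow> x0 \<le> x \<and> x < x0 + int k \<and> y \<in> extent (I x) \<and> z \<in> extent (J x)"
    for x y z
  proof
    assume "(x, y, z) \<in> P"
    moreover from this have x: "x \<in> fst ` P" by force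
    ultimately have "(x, y, z) \<in> layer P x" by (simp add: layer_def)
    then show "x0 \<le> x \<and> x < x0 + int k \<and> y \<in> extent (I x) \<and> z \<in> extent (J x)"
      using IJ[OF x] range[OF x] by simp
  next
    assume *: "x0 \<le> x \<and> x < x0 + int k \<and> y \<in> extent (I x) \<and> z \<in> extent (J x)"
    then have "(x, y, z) \<in> layer P x" using IJ[OF all[of x]] by simp
    then show "(x, y, z) \<in> P" by (simp add: layer_def)
  qed
  define shifted where "shifted f = map (\<lambda>t. (fst (f (x0 + int t)) - fst (f x0), snd (f (x0 + int t)))) [0..<k]"
    for f :: "int \<Rightarrow> int \<times> nat"
  have len: "length (shifted f) = k" for f
    by (simp add: shifted_def)
  have hd: "fst (hd (shifted f)) = 0" for f
    using kpos by (simp add: shifted_def hd_map)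
  have ext: "y \<in> extent (shifted f ! t) \<longleftrightarrow> fst (f x0) + y \<in> extent (f (x0 + int t))"
    if "t < k" for f t y
    using that by (auto simp: shifted_def extent_def)
  have chain: "chain (shifted f)"
    if pos: "\<And>x. x0 \<le> x \<Longrightarrow> x < x0 + int k \<Longrightarrow> 0 < snd (f x)"
      and meet: "\<And>x. x0 \<le> x \<Longrightarrow> x < x0 + int k - 1 \<Longrightarrow> \<exists>y. y \<in> extent (f x) \<and> y \<in> extent (f (x + 1))"
    for f
    unfolding chain_def successively_conv_nth
  proof (intro conjI ballI allI impI)
    fix K assume "K \<in> set (shifted f)"
    then show "0 < snd K" using pos by (auto simp: shifted_def)
  next
    fix t assume t: "Suc t < length (shifted f)"
    then obtain y where "y \<in> extent (f (x0 + int t))" "y \<in> extent (f (x0 + int t + 1))"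
      using meet[of "x0 + int t"] len by auto
    then have "y - fst (f x0) \<in> extent (shifted f ! t) \<inter> extent (shifted f ! Suc t)"
      using t len by (simp add: ext add.assoc add.commute[of 1])
    then show "extent (shifted f ! t) \<inter> extent (shifted f ! Suc t) \<noteq> {}" by blast
  qed
  have "chain (shifted I)" "chain (shifted J)"
    using IJ[OF all] cross by (intro chain; simp add: mem; blast)+
  moreover have "P = (+) (x0, fst (I x0), fst (J x0)) ` stack (shifted I) (shifted J)" (is "_ = (+) ?v ` ?S")
  proof (intro equalityI subsetI)
    fix c assume c: "c \<in> P"
    obtain x y z where xyz: "c = (x, y, z)" by (cases c)
    have "(x - x0, y - fst (I x0), z - fst (J x0)) \<in> ?S"
      using c unfolding xyz mem by (auto simp: stack_def len ext)
    then show "c \<in> (+) ?v ` ?S"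
      by (rule rev_image_eqI) (simp add: xyz)
  next
    fix c assume "c \<in> (+) ?v ` ?S"
    then show "c \<in> P"
      by (auto simp: stack_def mem len ext)
  qed
  ultimately show ?thesis
    using that len hd by blast
qed

section \<open>Uniqueness of the normalised stack\<close>

lemma stack_inject:
  assumes "chain A" "chain B" "length A = k" "length B = k"
    and "chain A'" "chain B'" "length A' = k" "length B' = k"
    and eq: "stack A B = stack A' B'"
  shows "A = A'" "B = B'"
proof -
  have "A ! t = A' ! t \<and> B ! t = B' ! t" if t: "t < k" for t
  proof -
    have mem: "y \<in> extent (A ! t) \<and> z \<in> extent (B ! t) \<longleftrightarrow> y \<in> extent (A' ! t) \<and> z \<in> extent (B' ! t)"
      for y z
    proof -
      have "(int t, y, z) \<in> stack A B \<longleftrightarrow> (int t, y, z) \<in> stack A' B'" by (simp only: eq)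
      then show ?thesis using t assms by (simp add: stack_def)
    qed
    have pos: "0 < snd (A ! t)" "0 < snd (B ! t)" "0 < snd (A' ! t)" "0 < snd (B' ! t)"
      using assms(1-8) t by (simp_all add: chain_nth_pos)
    note ends = pos[THEN left_end_in_extent]
    have "extent (A ! t) = extent (A' ! t)"
    proof (rule set_eqI)
      fix y
      show "y \<in> extent (A ! t) \<longleftrightarrow> y \<in> extent (A' ! t)"
        using mem[of y "fst (B ! t)"] mem[of y "fst (B' ! t)"] ends by auto
    qed
    moreover have "extent (B ! t) = extent (B' ! t)"
    proof (rule set_eqI)
      fix z
      show "z \<in> extent (B ! t) \<longleftrightarrow> z \<in> extent (B' ! t)"
        using mem[of "fst (A ! t)" z] mem[of "fst (A' ! t)" z] ends by auto
    qed
    ultimately show ?thesis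
      by (intro conjI extent_inject pos)
  qed
  then show "A = A'" "B = B'"
    using assms by (auto intro!: nth_equalityI)
qed

lemma origin_in_stack:
  assumes "chain A" "chain B" "length A = length B" "A \<noteq> []" "fst (hd A) = 0" "fst (hd B) = 0"
  shows "(0, 0, 0) \<in> stack A B"
proof -
  have "B \<noteq> []" using assms(3,4) by auto
  then show ?thesis
    using assms chain_nth_pos[of A 0] chain_nth_pos[of B 0]
    by (simp add: stack_def extent_def hd_conv_nth)
qed

text \<open>The origin is the least corner of the first layer of a normalised stack. A translation between
  two normalised stacks moves the origin to a cell of the second and its inverse moves it to a cell
  of the first, so these bounds, applied to both, force it to be trivial.\<close>

lemma stack_lower_bounds:
  assumes "(x, y, z) \<in> stack A B" "fst (hd A) = 0" "fst (hd B) = 0" "length A = length B"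
  shows "0 \<le> x" "x = 0 \<Longrightarrow> 0 \<le> y \<and> 0 \<le> z"
proof -
  show "0 \<le> x" using assms by (simp add: stack_def)
  have "A \<noteq> []" "B \<noteq> []" using assms by (auto simp: stack_def)
  then show "x = 0 \<Longrightarrow> 0 \<le> y \<and> 0 \<le> z"
    using assms by (auto simp: stack_def extent_def hd_conv_nth)
qed

lemma translated_stacks_eq:
  assumes "chain A" "chain B" "length A = k" "length B = k" "fst (hd A) = 0" "fst (hd B) = 0"
    and "chain A'" "chain B'" "length A' = k" "length B' = k" "fst (hd A') = 0" "fst (hd B') = 0"
    and k: "0 < k" and eq: "stack A' B' = (+) v ` stack A B"
  shows "A = A' \<and> B = B'"
proof -
  obtain a b c where v: "v = (a, b, c)" by (cases v)
  have AB: "(0, 0, 0) \<in> stack A B" and AB': "(0, 0, 0) \<in> stack A' B'"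
    using assms by (auto intro!: origin_in_stack)
  have "v + (0, 0, 0) \<in> stack A' B'"
    unfolding eq by (rule imageI[OF AB])
  then have v_mem: "(a, b, c) \<in> stack A' B'"
    by (simp add: v)
  obtain p where p: "p \<in> stack A B" "(0, 0, 0) = v + p"
    using AB' unfolding eq by (rule imageE)
  obtain x y z where xyz: "p = (x, y, z)" by (cases p)
  have sum: "a + x = 0" "b + y = 0" "c + z = 0"
    using p(2) by (simp_all add: v xyz)
  have len: "length A = length B" "length A' = length B'"
    using assms by simp_all
  note lower = stack_lower_bounds[OF v_mem assms(11,12) len(2)]
    stack_lower_bounds[OF p(1)[unfolded xyz] assms(5,6) len(1)]
  have "a = 0" "x = 0" using lower(1,3) sum(1) by linarith+
  moreover from this have "b = 0" "c = 0" using lower(2,4) sum(2,3) by linarith+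
  ultimately have "v = 0" by (simp add: v zero_prod_def)
  then have same: "stack A B = stack A' B'"
    using eq by (simp only: image_add_0)
  show ?thesis
    by (intro conjI stack_inject[OF assms(1-4,7-10) same])
qed

lemma lateral_area_translate: "lateral_area ((+) v ` P) = lateral_area P"
proof -
  obtain a b c where v: "v = (a, b, c)" by (cases v)
  have xy: "(\<lambda>(x, y, z). (x, y)) ` (+) v ` P = (+) (a, b) ` (\<lambda>(x, y, z). (x, y)) ` P"
    unfolding image_image by (rule image_cong) (auto simp: v)
  have xz: "(\<lambda>(x, y, z). (x, z)) ` (+) v ` P = (+) (a, c) ` (\<lambda>(x, y, z). (x, z)) ` P"
    unfolding image_image by (rule image_cong) (auto simp: v)
  have card: "card ((+) w ` Q) = card Q" for w :: "int \<times> int" and Q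
    by (rule card_image) (rule inj_on_add)
  show ?thesis
    unfolding lateral_area_def xy xz card ..
qed

section \<open>Counting\<close>

text \<open>Normalised pairs of chains are a system of representatives of the translation classes.\<close>

lemma num_plateau_polycubes_eq_card:
  assumes k: "0 < k"
  shows "num_plateau_polycubes (int k) (int m)
     = card (\<Union>u\<in>{k..m - k}. based_chains k u \<times> based_chains k (m - u))"
proof -
  let ?S = "{P. plateau_polycube P \<and> width P = int k \<and> int (lateral_area P) = int m}"
  let ?T = "\<Union>u\<in>{k..m - k}. based_chains k u \<times> based_chains k (m - u)"
  let ?cls = "\<lambda>(A, B). translation_rel `` {stack A B}"
  have T: "(A, B) \<in> ?T \<longleftrightarrow> chain A \<and> chain B \<and> length A = k \<and> length B = k \<and>
      fst (hd A) = 0 \<and> fst (hd B) = 0 \<and> total_length A + total_length B = m" for A B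
    using length_le_total_length[of A] length_le_total_length[of B]
    by (auto simp: based_chains_def)
  have "bij_betw ?cls ?T (?S // translation_rel)"
  proof (rule bij_betw_imageI)
    show "inj_on ?cls ?T"
    proof (rule inj_onI)
      fix p q assume p: "p \<in> ?T" and q: "q \<in> ?T" and cls: "?cls p = ?cls q"
      obtain A B A' B' where pq: "p = (A, B)" "q = (A', B')"
        by (cases p; cases q)
      note AB = p[unfolded pq T] and AB' = q[unfolded pq T]
      have "translation_rel `` {stack A B} = translation_rel `` {stack A' B'}"
        using cls by (simp add: pq)
      then have "(stack A B, stack A' B') \<in> translation_rel"
        by (rule eq_equiv_class[OF _ equiv_translation_rel UNIV_I])
      then obtain v where v: "stack A' B' = (+) v ` stack A B"
        unfolding translation_rel_def by blast
      have "A = A' \<and> B = B'"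
        by (rule translated_stacks_eq[OF _ _ _ _ _ _ _ _ _ _ _ _ k v]) (use AB AB' in simp_all)
      then show "p = q" by (simp add: pq)
    qed
    show "?cls ` ?T = ?S // translation_rel"
    proof (intro equalityI subsetI)
      fix X assume "X \<in> ?cls ` ?T"
      then obtain A B where AB: "(A, B) \<in> ?T" and X: "X = translation_rel `` {stack A B}" by auto
      have "stack A B \<in> ?S"
        using AB k plateau_polycube_stack[of A B] width_stack[of A B] lateral_area_stack[of A B]
        unfolding T by auto
      then show "X \<in> ?S // translation_rel" unfolding X by (rule quotientI)
    next
      fix X assume "X \<in> ?S // translation_rel"
      then obtain P where P: "P \<in> ?S" and X: "X = translation_rel `` {P}"
        by (rule quotientE)
      then obtain A B v where AB: "chain A" "chain B" "length A = k" "length B = k"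
          "fst (hd A) = 0" "fst (hd B) = 0" and Pv: "P = (+) v ` stack A B"
        using plateau_polycube_cases[of P k] by blast
      have "lateral_area P = total_length A + total_length B"
        unfolding Pv lateral_area_translate using AB k by (intro lateral_area_stack) auto
      then have "(A, B) \<in> ?T" using AB P unfolding T by simp
      moreover have "(stack A B, P) \<in> translation_rel"
        unfolding translation_rel_def using Pv by blast
      then have "X = translation_rel `` {stack A B}"
        unfolding X by (rule equiv_class_eq[OF equiv_translation_rel, symmetric])
      ultimately show "X \<in> ?cls ` ?T" by force
    qed
  qed
  then show ?thesis
    unfolding num_plateau_polycubes_def by (simp only: bij_betw_same_card)
qed

theorem theorem4p1:
  fixes k m :: int
  assumes "k \<ge> 1" and "m \<ge> 2 * k"
  shows "num_plateau_polycubes k m = (\<Sum>i = k..m - k. alpha k i * alpha k (m - i))"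
proof -
  obtain n where k: "k = int (Suc n)"
    using that[of "nat (k - 1)"] assms(1) by simp
  obtain M where m: "m = int M"
    using that[of "nat m"] assms by simp
  let ?k = "Suc n"
  have "num_plateau_polycubes k m
      = card (\<Union>u\<in>{?k..M - ?k}. based_chains ?k u \<times> based_chains ?k (M - u))"
    unfolding k m by (rule num_plateau_polycubes_eq_card) simp
  also have "\<dots> = (\<Sum>u\<in>{?k..M - ?k}. card (based_chains ?k u \<times> based_chains ?k (M - u)))"
    by (intro card_UN_disjoint) (auto simp: finite_based_chains, auto simp: based_chains_def)
  also have "\<dots> = (\<Sum>u\<in>{?k..M - ?k}. alpha k (int u) * alpha k (int (M - u)))"
    by (simp only: card_cartesian_product card_based_chains k)
  also have "\<dots> = (\<Sum>i = k..m - k. alpha k i * alpha k (m - i))"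
    by (rule sum.reindex_bij_witness[of _ nat int]) (use assms in \<open>auto simp: k m\<close>)
  finally show ?thesis .
qed

end
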